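(* Let $R$ be a commutative ring, $p \in R[y_1, \dots, y_d]$, $x \in R^d$, and $v_1, \dots, v_k \in R^d$. Let $C_k = R[t][x_1,\dots,x_k]/(x_i^2 - t x_i : 1\le i\le k)$ and expand $$p\big(x + \textstyle\sum_i v_i x_i\big) = \sum_{S \subseteq [k]} c_S(t)\, x^S \quad\text{in } C_k.$$ Then $$c_S(t) = \frac{1}{t^{|S|}}\, \Delta(p;\, x;\, (tv_i)_{i \in S}), \qquad c_S(0) = D(p;\, x;\, v_S).$$ The coefficients $c_S(t)$ lie in $R[t]$; in particular, $\Delta(p; x; tv_1, \dots, tv_k)$ is divisible by $t^k$ in $R[t]$.
   Context: $[k]=\{1,\dots,k\}$. $C_k$ is a free $R[t]$-module with basis $x^S=\prod_{i\in S}x_i$, $S\subseteq[k]$. The forward difference is $\Delta(p;x;(w_i)_{i\in I})=\sum_{J\subseteq I}(-1)^{|I|-|J|}p(x+\sum_{i\in J}w_i)$, here evaluated over $R[t]$. $D(p;x;v_S)$, with $v_S=(v_i)_{i\in S}$, denotes the coefficient of $\varepsilon^S=\prod_{i\in S}\varepsilon_i$ in $p(x+\sum_i v_i\varepsilon_i)$ in the algebra $A_k=R[\varepsilon_1,\dots,\varepsilon_k]/(\varepsilon_i^2)$ (the iterated directional derivative when $\mathbb{Q}\subseteq R$). *)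

theory Defs
  imports "HOL-Algebra.Algebra" "HOL-Algebra.Algebraic_Closure_Type" "HOL-Computational_Algebra.Polynomial"
begin

(* Polynomials in variables indexed by nat: finitely supported maps from exponent vectors to
   coefficients, with the ring structure (convolution product) of HOL-Library.Poly_Mapping. *)
type_synonym 'b mpoly = "(nat \<Rightarrow>\<^sub>0 nat) \<Rightarrow>\<^sub>0 'b"

definition mvars :: "'b::zero mpoly \<Rightarrow> nat set" where
  "mvars p = (\<Union>m\<in>Poly_Mapping.keys p. Poly_Mapping.keys m)"

definition mconst :: "'b::zero \<Rightarrow> 'b mpoly" where
  "mconst b = Poly_Mapping.single 0 b"

definition mvar :: "nat \<Rightarrow> 'b::zero_neq_one mpoly" where
  "mvar i = Poly_Mapping.single (Poly_Mapping.single i 1) 1"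

definition mpoly_ring :: "nat set \<Rightarrow> 'b::comm_ring_1 mpoly ring" where
  "mpoly_ring V = ring_of_type_algebra \<lparr>carrier := {p. mvars p \<subseteq> V}\<rparr>"

(* Value of p at y in the ring Q, where Q is an algebra via the structure map \<phi>. *)
definition mpoly_eval ::
  "('q, 'm) ring_scheme \<Rightarrow> ('a::zero \<Rightarrow> 'q) \<Rightarrow> 'a mpoly \<Rightarrow> (nat \<Rightarrow> 'q) \<Rightarrow> 'q" where
  "mpoly_eval Q \<phi> p y =
     (\<Oplus>\<^bsub>Q\<^esub>m\<in>Poly_Mapping.keys p. \<phi> (Poly_Mapping.lookup p m) \<otimes>\<^bsub>Q\<^esub>
        (\<Otimes>\<^bsub>Q\<^esub>j\<in>Poly_Mapping.keys m. y j [^]\<^bsub>Q\<^esub> Poly_Mapping.lookup m j))"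

(* The point x + (sum over i in [k] of v_i g_i) of Q^d, again with structure map \<phi>. *)
definition shifted_point ::
  "('q, 'm) ring_scheme \<Rightarrow> ('a \<Rightarrow> 'q) \<Rightarrow> (nat \<Rightarrow> 'q) \<Rightarrow> nat \<Rightarrow>
     (nat \<Rightarrow> 'a) \<Rightarrow> (nat \<Rightarrow> nat \<Rightarrow> 'a) \<Rightarrow> nat \<Rightarrow> 'q" where
  "shifted_point Q \<phi> g k x v =
     (\<lambda>j. \<phi> (x j) \<oplus>\<^bsub>Q\<^esub> (\<Oplus>\<^bsub>Q\<^esub>i\<in>{1..k}. \<phi> (v i j) \<otimes>\<^bsub>Q\<^esub> g i))"

definition sqfree_sum ::
  "('q, 'm) ring_scheme \<Rightarrow> ('b \<Rightarrow> 'q) \<Rightarrow> (nat \<Rightarrow> 'q) \<Rightarrow> nat \<Rightarrow> (nat set \<Rightarrow> 'b) \<Rightarrow> 'q" where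
  "sqfree_sum Q \<phi> g k c =
     (\<Oplus>\<^bsub>Q\<^esub>S\<in>Pow {1..k}. \<phi> (c S) \<otimes>\<^bsub>Q\<^esub> (\<Otimes>\<^bsub>Q\<^esub>i\<in>S. g i))"

abbreviation tpoly :: "'a::comm_ring_1 poly" where
  "tpoly \<equiv> [:0, 1:]"

definition C_ideal :: "nat \<Rightarrow> 'a::comm_ring_1 poly mpoly set" where
  "C_ideal k = Idl\<^bsub>mpoly_ring {1..k}\<^esub> ((\<lambda>i. mvar i ^ 2 - mconst tpoly * mvar i) ` {1..k})"

definition C_ring :: "nat \<Rightarrow> 'a::comm_ring_1 poly mpoly set ring" where
  "C_ring k = mpoly_ring {1..k} Quot C_ideal k"

definition C_const :: "nat \<Rightarrow> 'a::comm_ring_1 poly \<Rightarrow> 'a poly mpoly set" where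
  "C_const k a = C_ideal k +>\<^bsub>mpoly_ring {1..k}\<^esub> mconst a"

definition C_var :: "nat \<Rightarrow> nat \<Rightarrow> 'a::comm_ring_1 poly mpoly set" where
  "C_var k i = C_ideal k +>\<^bsub>mpoly_ring {1..k}\<^esub> mvar i"

definition C_value ::
  "nat \<Rightarrow> 'a::comm_ring_1 mpoly \<Rightarrow> (nat \<Rightarrow> 'a) \<Rightarrow> (nat \<Rightarrow> nat \<Rightarrow> 'a) \<Rightarrow> 'a poly mpoly set" where
  "C_value k p x v =
     (let \<phi> = (\<lambda>a. C_const k [:a:])
      in mpoly_eval (C_ring k) \<phi> p (shifted_point (C_ring k) \<phi> (C_var k) k x v))"

definition A_ideal :: "nat \<Rightarrow> 'a::comm_ring_1 mpoly set" where
  "A_ideal k = Idl\<^bsub>mpoly_ring {1..k}\<^esub> ((\<lambda>i. mvar i ^ 2) ` {1..k})"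

definition A_ring :: "nat \<Rightarrow> 'a::comm_ring_1 mpoly set ring" where
  "A_ring k = mpoly_ring {1..k} Quot A_ideal k"

definition A_const :: "nat \<Rightarrow> 'a::comm_ring_1 \<Rightarrow> 'a mpoly set" where
  "A_const k a = A_ideal k +>\<^bsub>mpoly_ring {1..k}\<^esub> mconst a"

definition A_var :: "nat \<Rightarrow> nat \<Rightarrow> 'a::comm_ring_1 mpoly set" where
  "A_var k i = A_ideal k +>\<^bsub>mpoly_ring {1..k}\<^esub> mvar i"

definition A_value ::
  "nat \<Rightarrow> 'a::comm_ring_1 mpoly \<Rightarrow> (nat \<Rightarrow> 'a) \<Rightarrow> (nat \<Rightarrow> nat \<Rightarrow> 'a) \<Rightarrow> 'a mpoly set" where
  "A_value k p x v =
     mpoly_eval (A_ring k) (A_const k) p (shifted_point (A_ring k) (A_const k) (A_var k) k x v)"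

(* D(p; x; v_S) for S \<subseteq> [k].  The description is proper because A_k is a free R-module on the
   squarefree monomials. *)
definition D_coeff ::
  "nat \<Rightarrow> 'a::comm_ring_1 mpoly \<Rightarrow> (nat \<Rightarrow> 'a) \<Rightarrow> (nat \<Rightarrow> nat \<Rightarrow> 'a) \<Rightarrow> nat set \<Rightarrow> 'a" where
  "D_coeff k p x v S =
     (THE a. \<exists>c. A_value k p x v = sqfree_sum (A_ring k) (A_const k) (A_var k) k c \<and> a = c S)"

definition fwd_diff ::
  "((nat \<Rightarrow> 'b) \<Rightarrow> 'b) \<Rightarrow> (nat \<Rightarrow> 'b) \<Rightarrow> nat set \<Rightarrow> (nat \<Rightarrow> nat \<Rightarrow> 'b) \<Rightarrow> 'b::comm_ring_1" where
  "fwd_diff f x I w =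
     (\<Sum>J\<in>Pow I. (-1) ^ (card I - card J) * f (\<lambda>j. x j + (\<Sum>i\<in>J. w i j)))"

(* \<Delta>(p; x; (t v_i) for i in I), evaluated over R[t]. *)
definition fwd_diff_t ::
  "'a::comm_ring_1 mpoly \<Rightarrow> (nat \<Rightarrow> 'a) \<Rightarrow> (nat \<Rightarrow> nat \<Rightarrow> 'a) \<Rightarrow> nat set \<Rightarrow> 'a poly" where
  "fwd_diff_t p x v I =
     fwd_diff (mpoly_eval ring_of_type_algebra (\<lambda>a. [:a:]) p)
       (\<lambda>j. [:x j:]) I (\<lambda>i j. tpoly * [:v i j:])"

end

theory Submission
  imports Defs
begin

text \<open>
  Write \<open>P = p(x + (\<Sum>i. v i * x\<^sub>i))\<close> for the value of \<open>p\<close> in the polynomial ring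
  \<open>R[t][x\<^sub>1,\<dots>,x\<^sub>k]\<close>, before passing to the quotient. The relation \<open>x\<^sub>i\<^sup>2 = t x\<^sub>i\<close> rewrites every
  monomial to a power of \<open>t\<close> times a squarefree monomial, so \<open>P\<close> is congruent to some
  \<open>\<Sum>S. c S * x\<^sup>S\<close> (\<open>C_reducible_all\<close>). Both formulas for \<open>c S\<close> come from ring homomorphisms that
  respect the relation.

  The equation \<open>X\<^sup>2 = t X\<close> has the roots \<open>0\<close> and \<open>t\<close> in \<open>R[t]\<close>. Hence for each \<open>J \<subseteq> {1..k}\<close> one may
  put \<open>x\<^sub>i = t\<close> for \<open>i \<in> J\<close> and \<open>x\<^sub>i = 0\<close> for the other \<open>i\<close>, which yields
  \<open>p(x + (\<Sum>i\<in>J. t * v i)) = (\<Sum>S\<in>Pow J. t^card S * c S)\<close> (\<open>C_expansion_at_vertex\<close>). Moebius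
  inversion over subsets gives \<open>t^card S * c S\<close> as the forward difference (\<open>fwd_diff_t_eq\<close>); as \<open>t\<close> is
  not a zero divisor, this determines \<open>c S\<close>. The divisibility claim is the case \<open>S = {1..k}\<close>.

  Setting \<open>t = 0\<close> in the coefficients turns \<open>x\<^sub>i\<^sup>2 - t x\<^sub>i\<close> into \<open>x\<^sub>i\<^sup>2\<close>, so the expansion of \<open>P\<close> in \<open>C\<^sub>k\<close>
  specializes to an expansion in \<open>A\<^sub>k\<close> with coefficients \<open>c S\<close> at \<open>0\<close> (\<open>specialization_C_to_A\<close>).
  Expansions in \<open>A\<^sub>k\<close> are unique, because each monomial of a member of the ideal generated by the
  \<open>x\<^sub>i\<^sup>2\<close> contains a square (\<open>sqfree_poly_in_A_ideal\<close>), so these coefficients are the ones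
  that define \<open>D\<close>.
\<close>

section \<open>Rings of polynomials as subrings of a type\<close>

lemma type_algebra_simps [simp]:
  "carrier (ring_of_type_algebra :: 'b::comm_ring_1 ring) = UNIV"
  "\<zero>\<^bsub>ring_of_type_algebra\<^esub> = (0 :: 'b)"
  "\<one>\<^bsub>ring_of_type_algebra\<^esub> = (1 :: 'b)"
  "(a :: 'b) \<oplus>\<^bsub>ring_of_type_algebra\<^esub> b = a + b"
  "(a :: 'b) \<otimes>\<^bsub>ring_of_type_algebra\<^esub> b = a * b"
  by (simp_all add: ring_of_type_algebra_def)

lemma mpoly_ring_simps [simp]:
  "f \<in> carrier (mpoly_ring V) \<longleftrightarrow> mvars f \<subseteq> V"
  "\<zero>\<^bsub>mpoly_ring V\<^esub> = (0 :: 'b::comm_ring_1 mpoly)"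
  "\<one>\<^bsub>mpoly_ring V\<^esub> = (1 :: 'b mpoly)"
  "(f :: 'b mpoly) \<oplus>\<^bsub>mpoly_ring V\<^esub> g = f + g"
  "(f :: 'b mpoly) \<otimes>\<^bsub>mpoly_ring V\<^esub> g = f * g"
  by (simp_all add: mpoly_ring_def)

lemma mvars_zero [simp]: "mvars 0 = {}"
  by (simp add: mvars_def)

lemma mvars_one [simp]: "mvars (1 :: 'b::comm_ring_1 mpoly) = {}"
  by (simp add: mvars_def)

lemma mvars_single: "mvars (Poly_Mapping.single m b) \<subseteq> Poly_Mapping.keys m"
  by (simp add: mvars_def)

lemma mvars_mconst [simp]: "mvars (mconst b) = {}"
  by (simp add: mvars_def mconst_def)

lemma mvars_mvar [simp]: "mvars (mvar i :: 'b::comm_ring_1 mpoly) = {i}"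
  by (simp add: mvars_def mvar_def)

lemma mvars_uminus [simp]: "mvars (- f :: 'b::comm_ring_1 mpoly) = mvars f"
  by (simp add: mvars_def Poly_Mapping.keys.rep_eq)

lemma mvars_add: "mvars (f + g :: 'b::comm_ring_1 mpoly) \<subseteq> mvars f \<union> mvars g"
  using Poly_Mapping.keys_add[of f g] by (auto simp: mvars_def)

lemma mvars_mult: "mvars (f * g :: 'b::comm_ring_1 mpoly) \<subseteq> mvars f \<union> mvars g"
proof
  fix i assume "i \<in> mvars (f * g)"
  then obtain a b where "a \<in> Poly_Mapping.keys f" "b \<in> Poly_Mapping.keys g"
    and "i \<in> Poly_Mapping.keys (a + b)"
    using keys_mult[of f g] by (auto simp: mvars_def)
  with Poly_Mapping.keys_add[of a b] show "i \<in> mvars f \<union> mvars g"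
    by (auto simp: mvars_def)
qed

lemma mvars_mult_subset: "mvars f \<subseteq> V \<Longrightarrow> mvars g \<subseteq> V \<Longrightarrow> mvars (f * g :: 'b::comm_ring_1 mpoly) \<subseteq> V"
  using mvars_mult by blast

lemma mvars_add_subset: "mvars f \<subseteq> V \<Longrightarrow> mvars g \<subseteq> V \<Longrightarrow> mvars (f + g :: 'b::comm_ring_1 mpoly) \<subseteq> V"
  using mvars_add by blast

lemma mvars_diff_subset: "mvars f \<subseteq> V \<Longrightarrow> mvars g \<subseteq> V \<Longrightarrow> mvars (f - g :: 'b::comm_ring_1 mpoly) \<subseteq> V"
  using mvars_add[of f "- g"] by auto

lemma mvars_sum_subset:
  "(\<And>a. a \<in> A \<Longrightarrow> mvars (f a) \<subseteq> V) \<Longrightarrow> mvars (\<Sum>a\<in>A. f a :: 'b::comm_ring_1 mpoly) \<subseteq> V"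
  by (induction A rule: infinite_finite_induct) (simp_all add: mvars_add_subset)

lemma mvars_prod_subset:
  "(\<And>a. a \<in> A \<Longrightarrow> mvars (f a) \<subseteq> V) \<Longrightarrow> mvars (\<Prod>a\<in>A. f a :: 'b::comm_ring_1 mpoly) \<subseteq> V"
  by (induction A rule: infinite_finite_induct) (simp_all add: mvars_mult_subset)

lemma cring_mpoly_ring: "cring (mpoly_ring V :: 'b::comm_ring_1 mpoly ring)"
proof -
  interpret T: cring "ring_of_type_algebra :: 'b mpoly ring"
    by (rule cring_from_type_algebra)
  have minus: "\<ominus>\<^bsub>ring_of_type_algebra\<^esub> f = - f" for f :: "'b mpoly"
    by (rule T.minus_equality) simp_all
  have "subring {f :: 'b mpoly. mvars f \<subseteq> V} ring_of_type_algebra"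
    by (rule T.subringI) (simp_all add: minus mvars_mult_subset mvars_add_subset)
  then have "subcring {f :: 'b mpoly. mvars f \<subseteq> V} ring_of_type_algebra"
    by (rule T.subcringI')
  then show ?thesis
    unfolding mpoly_ring_def by (subst T.subcring_iff [symmetric]) simp_all
qed

lemma mpoly_ring_uminus:
  assumes "mvars (f :: 'b::comm_ring_1 mpoly) \<subseteq> V"
  shows "\<ominus>\<^bsub>mpoly_ring V\<^esub> f = - f"
proof -
  interpret M: cring "mpoly_ring V :: 'b mpoly ring"
    by (rule cring_mpoly_ring)
  show ?thesis
    by (rule M.minus_equality) (use assms in simp_all)
qed

lemma finsum_mpoly_ring:
  assumes "\<And>a. a \<in> A \<Longrightarrow> mvars (f a :: 'b::comm_ring_1 mpoly) \<subseteq> V"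
  shows "finsum (mpoly_ring V) f A = sum f A"
proof -
  interpret M: cring "mpoly_ring V :: 'b mpoly ring"
    by (rule cring_mpoly_ring)
  show ?thesis
    using assms by (induction A rule: infinite_finite_induct) (auto simp: Pi_def)
qed

lemma finprod_mpoly_ring:
  assumes "\<And>a. a \<in> A \<Longrightarrow> mvars (f a :: 'b::comm_ring_1 mpoly) \<subseteq> V"
  shows "finprod (mpoly_ring V) f A = prod f A"
proof -
  interpret M: cring "mpoly_ring V :: 'b mpoly ring"
    by (rule cring_mpoly_ring)
  show ?thesis
    using assms by (induction A rule: infinite_finite_induct) (auto simp: Pi_def)
qed

lemma finsum_type_algebra [simp]:
  "finsum ring_of_type_algebra f A = (sum f A :: 'b::comm_ring_1)"
proof -
  interpret T: cring "ring_of_type_algebra :: 'b ring"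
    by (rule cring_from_type_algebra)
  show ?thesis
    by (induction A rule: infinite_finite_induct) (auto simp: Pi_def)
qed

lemma finprod_type_algebra [simp]:
  "finprod ring_of_type_algebra f A = (prod f A :: 'b::comm_ring_1)"
proof -
  interpret T: cring "ring_of_type_algebra :: 'b ring"
    by (rule cring_from_type_algebra)
  show ?thesis
    by (induction A rule: infinite_finite_induct) (auto simp: Pi_def)
qed

section \<open>Ring homomorphisms commute with evaluation\<close>

context cring
begin

lemma mpoly_eval_closed:
  assumes "\<And>a. \<phi> a \<in> carrier R" "\<And>j. y j \<in> carrier R"
  shows "mpoly_eval R \<phi> p y \<in> carrier R"
  unfolding mpoly_eval_def
  using assms by (intro finsum_closed) (auto simp: Pi_def intro!: m_closed finprod_closed)

lemma shifted_point_closed: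
  assumes "\<And>a. \<phi> a \<in> carrier R" "\<And>i. i \<in> {1..k} \<Longrightarrow> g i \<in> carrier R"
  shows "shifted_point R \<phi> g k x v j \<in> carrier R"
  unfolding shifted_point_def
  using assms by (auto simp: Pi_def intro!: a_closed finsum_closed)

end

context ring_hom_cring
begin

lemma hom_mpoly_eval:
  assumes "\<And>a. \<phi> a \<in> carrier R" "\<And>j. y j \<in> carrier R"
  shows "h (mpoly_eval R \<phi> p y) = mpoly_eval S (\<lambda>a. h (\<phi> a)) p (\<lambda>j. h (y j))"
proof -
  have [simp]: "(\<Otimes>\<^bsub>R\<^esub>j\<in>A. y j [^]\<^bsub>R\<^esub> e j) \<in> carrier R" for A and e :: "nat \<Rightarrow> nat"
    using assms by (auto simp: Pi_def intro!: R.finprod_closed)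
  show ?thesis
    unfolding mpoly_eval_def using assms
    by (subst hom_finsum)
       (auto simp: Pi_def o_def hom_pow hom_finprod intro!: S.finsum_cong' S.m_closed S.finprod_closed)
qed

lemma hom_shifted_point:
  assumes "\<And>a. \<phi> a \<in> carrier R" "\<And>i. i \<in> {1..k} \<Longrightarrow> g i \<in> carrier R"
  shows "h (shifted_point R \<phi> g k x v j) =
    shifted_point S (\<lambda>a. h (\<phi> a)) (\<lambda>i. h (g i)) k x v j"
proof -
  have c: "(\<Oplus>\<^bsub>R\<^esub>i\<in>{1..k}. \<phi> (v i j) \<otimes>\<^bsub>R\<^esub> g i) \<in> carrier R"
    using assms by (auto simp: Pi_def intro!: R.finsum_closed)
  show ?thesis
    unfolding shifted_point_def using assms c
    by (auto simp: Pi_def o_def intro!: arg_cong2[where f = "(\<oplus>\<^bsub>S\<^esub>)"] S.finsum_cong')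
qed

lemma hom_sqfree_sum:
  assumes "\<And>a. \<phi> a \<in> carrier R" "\<And>i. i \<in> {1..k} \<Longrightarrow> g i \<in> carrier R"
  shows "h (sqfree_sum R \<phi> g k c) = sqfree_sum S (\<lambda>a. h (\<phi> a)) (\<lambda>i. h (g i)) k c"
proof -
  have c: "(\<Otimes>\<^bsub>R\<^esub>i\<in>A. g i) \<in> carrier R" and d: "h (\<Otimes>\<^bsub>R\<^esub>i\<in>A. g i) = (\<Otimes>\<^bsub>S\<^esub>i\<in>A. h (g i))"
    and e: "(\<Otimes>\<^bsub>S\<^esub>i\<in>A. h (g i)) \<in> carrier S"
    if "A \<subseteq> {1..k}" for A
    using assms that by (auto simp: Pi_def subset_iff o_def hom_finprod intro!: R.finprod_closed S.finprod_closed)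
  show ?thesis
    unfolding sqfree_sum_def using assms(1) c d e
    by (subst hom_finsum) (auto simp: Pi_def o_def intro!: S.finsum_cong')
qed

end

section \<open>The universal property of polynomial rings\<close>

text \<open>Keeping \<open>\<mu>\<close> general covers two maps at once: evaluation at a point, where \<open>\<mu>\<close> is the value of a
  monomial, and application of a ring homomorphism to every coefficient, where \<open>\<mu>\<close> is the
  monomial itself.\<close>
definition mpoly_lift :: "('b \<Rightarrow> 'c) \<Rightarrow> ((nat \<Rightarrow>\<^sub>0 nat) \<Rightarrow> 'c) \<Rightarrow> 'b::comm_ring_1 mpoly \<Rightarrow> 'c::comm_ring_1" where
  "mpoly_lift \<phi> \<mu> f =
     (\<Sum>m\<in>Poly_Mapping.keys f. \<phi> (Poly_Mapping.lookup f m) * \<mu> m)"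

lemma sum_single_lookup:
  "(\<Sum>m\<in>Poly_Mapping.keys f. Poly_Mapping.single m (Poly_Mapping.lookup f m)) = f"
  by (rule poly_mapping_eqI) (auto simp: lookup_sum lookup_single when_def in_keys_iff)

locale mpoly_lifting =
  fixes \<phi> :: "'b::comm_ring_1 \<Rightarrow> 'c::comm_ring_1" and \<mu> :: "(nat \<Rightarrow>\<^sub>0 nat) \<Rightarrow> 'c"
  assumes \<phi>_zero: "\<phi> 0 = 0" and \<phi>_one: "\<phi> 1 = 1"
    and \<phi>_add: "\<phi> (a + b) = \<phi> a + \<phi> b" and \<phi>_mult: "\<phi> (a * b) = \<phi> a * \<phi> b"
    and \<mu>_zero: "\<mu> 0 = 1" and \<mu>_add: "\<mu> (m + n) = \<mu> m * \<mu> n"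
begin

lemma lift_single [simp]: "mpoly_lift \<phi> \<mu> (Poly_Mapping.single m b) = \<phi> b * \<mu> m"
  by (simp add: mpoly_lift_def \<phi>_zero)

lemma lift_mconst [simp]: "mpoly_lift \<phi> \<mu> (mconst b) = \<phi> b"
  by (simp add: mconst_def \<mu>_zero)

lemma lift_mvar [simp]: "mpoly_lift \<phi> \<mu> (mvar i) = \<mu> (Poly_Mapping.single i 1)"
  by (simp add: mvar_def \<phi>_one)

lemma lift_add: "mpoly_lift \<phi> \<mu> (f + g) = mpoly_lift \<phi> \<mu> f + mpoly_lift \<phi> \<mu> g"
  unfolding mpoly_lift_def
  by (rule setsum_keys_plus_distrib) (simp_all add: \<phi>_zero \<phi>_add algebra_simps)

lemma lift_sum: "mpoly_lift \<phi> \<mu> (\<Sum>a\<in>A. f a) = (\<Sum>a\<in>A. mpoly_lift \<phi> \<mu> (f a))"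
proof (induction A rule: infinite_finite_induct)
qed (simp_all add: lift_add mpoly_lift_def[of _ _ 0])

lemma lift_mult: "mpoly_lift \<phi> \<mu> (f * g) = mpoly_lift \<phi> \<mu> f * mpoly_lift \<phi> \<mu> g"
proof -
  let ?f = "Poly_Mapping.lookup f" and ?g = "Poly_Mapping.lookup g"
  have "f * g = (\<Sum>m\<in>Poly_Mapping.keys f. Poly_Mapping.single m (?f m)) *
      (\<Sum>n\<in>Poly_Mapping.keys g. Poly_Mapping.single n (?g n))"
    by (simp add: sum_single_lookup)
  also have "\<dots> = (\<Sum>m\<in>Poly_Mapping.keys f. \<Sum>n\<in>Poly_Mapping.keys g.
      Poly_Mapping.single (m + n) (?f m * ?g n))"
    by (simp add: sum_product mult_single)
  finally have "mpoly_lift \<phi> \<mu> (f * g) =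
      (\<Sum>m\<in>Poly_Mapping.keys f. \<Sum>n\<in>Poly_Mapping.keys g. \<phi> (?f m * ?g n) * \<mu> (m + n))"
    by (simp add: lift_sum)
  also have "\<dots> = mpoly_lift \<phi> \<mu> f * mpoly_lift \<phi> \<mu> g"
    by (simp add: mpoly_lift_def sum_product \<phi>_mult \<mu>_add mult_ac)
  finally show ?thesis .
qed

lemma lift_uminus: "mpoly_lift \<phi> \<mu> (- f) = - mpoly_lift \<phi> \<mu> f"
  using lift_add[of f "- f"] by (simp add: mpoly_lift_def[of _ _ 0] eq_neg_iff_add_eq_0 add.commute)

lemma lift_diff: "mpoly_lift \<phi> \<mu> (f - g) = mpoly_lift \<phi> \<mu> f - mpoly_lift \<phi> \<mu> g"
  using lift_add[of f "- g"] by (simp add: lift_uminus)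

lemma lift_one: "mpoly_lift \<phi> \<mu> 1 = 1"
  using lift_mconst[of 1] by (simp add: mconst_def \<phi>_one)

lemma lift_ring_hom: "mpoly_lift \<phi> \<mu> \<in> ring_hom (mpoly_ring V) ring_of_type_algebra"
  by (rule ring_hom_memI) (simp_all add: lift_add lift_mult lift_one)

end

definition monomial_value :: "(nat \<Rightarrow> 'b::comm_ring_1) \<Rightarrow> (nat \<Rightarrow>\<^sub>0 nat) \<Rightarrow> 'b" where
  "monomial_value y m = (\<Prod>j\<in>Poly_Mapping.keys m. y j ^ Poly_Mapping.lookup m j)"

lemma monomial_value_superset:
  assumes "finite A" "Poly_Mapping.keys m \<subseteq> A"
  shows "monomial_value y m = (\<Prod>j\<in>A. y j ^ Poly_Mapping.lookup m j)"
  unfolding monomial_value_def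
  by (rule prod.mono_neutral_left) (use assms in \<open>auto simp: in_keys_iff\<close>)

lemma monomial_value_add: "monomial_value y (m + n) = monomial_value y m * monomial_value y n"
proof -
  let ?A = "Poly_Mapping.keys m \<union> Poly_Mapping.keys n"
  have "monomial_value y (m + n) = (\<Prod>j\<in>?A. y j ^ Poly_Mapping.lookup (m + n) j)"
    by (rule monomial_value_superset) (simp_all add: Poly_Mapping.keys_add)
  also have "\<dots> = (\<Prod>j\<in>?A. y j ^ Poly_Mapping.lookup m j) * (\<Prod>j\<in>?A. y j ^ Poly_Mapping.lookup n j)"
    by (simp add: lookup_add power_add prod.distrib)
  also have "\<dots> = monomial_value y m * monomial_value y n"
    by (simp add: monomial_value_superset[of ?A])
  finally show ?thesis .
qed

lemma monomial_value_single: "monomial_value y (Poly_Mapping.single i 1) = y i"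
  by (simp add: monomial_value_def)

lemma mpoly_lifting_eval: "mpoly_lifting (\<lambda>b. b) (monomial_value y)"
  by standard (simp_all add: monomial_value_add monomial_value_def[of _ 0])

lemma mpoly_lifting_coeff_hom:
  "mpoly_lifting (\<lambda>q :: 'a::comm_ring_1 poly. mconst (poly q 0)) (\<lambda>m. Poly_Mapping.single m 1)"
  by standard (simp_all add: mconst_def single_add mult_single)

text \<open>The simplifier must not turn the index range \<open>{1..k}\<close> into \<open>{Suc 0..k}\<close>, because it occurs
  in the facts below as a parameter of ring structures.\<close>
declare One_nat_def [simp del]

section \<open>Computing in the quotient rings with representatives\<close>

text \<open>The representative, in the polynomial ring, of \<open>p(x + (\<Sum>i. v i * x\<^sub>i))\<close>: no relations
  between the variables \<open>x\<^sub>i\<close> are imposed yet.\<close>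
definition lifted_value ::
  "nat \<Rightarrow> ('a \<Rightarrow> 'b::comm_ring_1 mpoly) \<Rightarrow> 'a::zero mpoly \<Rightarrow> (nat \<Rightarrow> 'a) \<Rightarrow> (nat \<Rightarrow> nat \<Rightarrow> 'a) \<Rightarrow> 'b mpoly" where
  "lifted_value k \<phi> p x v =
     mpoly_eval (mpoly_ring {1..k}) \<phi> p (shifted_point (mpoly_ring {1..k}) \<phi> mvar k x v)"

definition sqfree_poly :: "nat \<Rightarrow> (nat set \<Rightarrow> 'b::comm_ring_1) \<Rightarrow> 'b mpoly" where
  "sqfree_poly k c = sqfree_sum (mpoly_ring {1..k}) mconst mvar k c"

lemma mvars_shifted_point:
  assumes "\<And>a. mvars (\<phi> a :: 'b::comm_ring_1 mpoly) \<subseteq> {1..k}"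
  shows "mvars (shifted_point (mpoly_ring {1..k}) \<phi> mvar k x v j) \<subseteq> {1..k}"
proof -
  interpret M: cring "mpoly_ring {1..k} :: 'b mpoly ring"
    by (rule cring_mpoly_ring)
  have "shifted_point (mpoly_ring {1..k}) \<phi> mvar k x v j \<in> carrier (mpoly_ring {1..k})"
    by (rule M.shifted_point_closed) (use assms in simp_all)
  then show ?thesis by simp
qed

lemma mvars_lifted_value:
  assumes "\<And>a. mvars (\<phi> a) \<subseteq> {1..k}"
  shows "mvars (lifted_value k \<phi> p x v) \<subseteq> {1..k}"
proof -
  interpret M: cring "mpoly_ring {1..k} :: 'b::comm_ring_1 mpoly ring"
    by (rule cring_mpoly_ring)
  have "lifted_value k \<phi> p x v \<in> carrier (mpoly_ring {1..k})"
    unfolding lifted_value_def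
    by (rule M.mpoly_eval_closed) (use assms in \<open>simp_all add: mvars_shifted_point\<close>)
  then show ?thesis by simp
qed

lemma sqfree_poly_altdef:
  "sqfree_poly k c = (\<Sum>S\<in>Pow {1..k}. mconst (c S) * (\<Prod>i\<in>S. mvar i))"
proof -
  have m: "finprod (mpoly_ring {1..k}) mvar S = (\<Prod>i\<in>S. mvar i :: 'a mpoly)"
    if "S \<subseteq> {1..k}" for S
    using that by (intro finprod_mpoly_ring) auto
  have "sqfree_poly k c =
      (\<Sum>S\<in>Pow {1..k}. mconst (c S) * finprod (mpoly_ring {1..k}) mvar S)"
    unfolding sqfree_poly_def sqfree_sum_def mpoly_ring_simps
    by (rule finsum_mpoly_ring, rule mvars_mult_subset)
       (auto simp: m intro!: mvars_prod_subset)
  also have "\<dots> = (\<Sum>S\<in>Pow {1..k}. mconst (c S) * (\<Prod>i\<in>S. mvar i))"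
    by (rule sum.cong) (simp_all add: m)
  finally show ?thesis .
qed

lemma mvars_sqfree_poly: "mvars (sqfree_poly k c) \<subseteq> {1..k}"
  unfolding sqfree_poly_altdef
  by (intro mvars_sum_subset mvars_mult_subset mvars_prod_subset) auto

lemma coset_hom:
  assumes "ideal I (mpoly_ring V)"
  shows "ring_hom_cring (mpoly_ring V) (mpoly_ring V Quot I) (\<lambda>f. I +>\<^bsub>mpoly_ring V\<^esub> f)"
  using ideal.rcos_ring_hom_cring[OF assms cring_mpoly_ring] .

lemma coset_eq_iff:
  assumes "ideal I (mpoly_ring V)" "mvars (f :: 'b::comm_ring_1 mpoly) \<subseteq> V" "mvars g \<subseteq> V"
  shows "I +>\<^bsub>mpoly_ring V\<^esub> f = I +>\<^bsub>mpoly_ring V\<^esub> g \<longleftrightarrow> f - g \<in> I"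
proof -
  interpret M: cring "mpoly_ring V :: 'b mpoly ring"
    by (rule cring_mpoly_ring)
  have "f \<ominus>\<^bsub>mpoly_ring V\<^esub> g = f - g"
    using assms by (simp add: a_minus_def mpoly_ring_uminus)
  then show ?thesis
    using M.quotient_eq_iff_same_a_r_cos[OF assms(1), of f g] assms by simp
qed

text \<open>The coset map is a ring homomorphism, so evaluating \<open>p\<close> in the quotient gives the coset of
  the value in the polynomial ring. Together with \<open>coset_sqfree_poly\<close> this turns an equation in \<open>C\<^sub>k\<close> or \<open>A\<^sub>k\<close>
  into the membership of a difference of polynomials in an ideal.\<close>
lemma coset_lifted_value:
  assumes "ideal I (mpoly_ring {1..k})" "\<And>a. mvars (\<phi> a) \<subseteq> {1..k}"
  shows "mpoly_eval (mpoly_ring {1..k} Quot I) (\<lambda>a. I +>\<^bsub>mpoly_ring {1..k}\<^esub> \<phi> a) p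
      (shifted_point (mpoly_ring {1..k} Quot I) (\<lambda>a. I +>\<^bsub>mpoly_ring {1..k}\<^esub> \<phi> a)
         (\<lambda>i. I +>\<^bsub>mpoly_ring {1..k}\<^esub> mvar i) k x v)
    = I +>\<^bsub>mpoly_ring {1..k}\<^esub> lifted_value k \<phi> p x v"
proof -
  interpret q: ring_hom_cring "mpoly_ring {1..k}" "mpoly_ring {1..k} Quot I"
    "\<lambda>f. I +>\<^bsub>mpoly_ring {1..k}\<^esub> f"
    by (rule coset_hom) fact
  have "I +>\<^bsub>mpoly_ring {1..k}\<^esub> shifted_point (mpoly_ring {1..k}) \<phi> mvar k x v j =
      shifted_point (mpoly_ring {1..k} Quot I) (\<lambda>a. I +>\<^bsub>mpoly_ring {1..k}\<^esub> \<phi> a)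
        (\<lambda>i. I +>\<^bsub>mpoly_ring {1..k}\<^esub> mvar i) k x v j" for j
    by (rule q.hom_shifted_point) (use assms(2) in simp_all)
  then show ?thesis
    unfolding lifted_value_def using assms(2)
    by (simp add: q.hom_mpoly_eval mvars_shifted_point)
qed

lemma coset_sqfree_poly:
  assumes "ideal I (mpoly_ring {1..k})"
  shows "sqfree_sum (mpoly_ring {1..k} Quot I) (\<lambda>a. I +>\<^bsub>mpoly_ring {1..k}\<^esub> mconst a)
      (\<lambda>i. I +>\<^bsub>mpoly_ring {1..k}\<^esub> mvar i) k c
    = I +>\<^bsub>mpoly_ring {1..k}\<^esub> sqfree_poly k c"
proof -
  interpret q: ring_hom_cring "mpoly_ring {1..k}" "mpoly_ring {1..k} Quot I"
    "\<lambda>f. I +>\<^bsub>mpoly_ring {1..k}\<^esub> f"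
    by (rule coset_hom) fact
  show ?thesis
    unfolding sqfree_poly_def by (subst q.hom_sqfree_sum) auto
qed

lemma ideal_C_ideal: "ideal (C_ideal k :: 'a::comm_ring_1 poly mpoly set) (mpoly_ring {1..k})"
  and C_ideal_generator: "i \<in> {1..k} \<Longrightarrow> mvar i ^ 2 - mconst tpoly * mvar i \<in> (C_ideal k :: 'a::comm_ring_1 poly mpoly set)"
  and C_ideal_minimal: "ideal I (mpoly_ring {1..k}) \<Longrightarrow>
    (\<And>i. i \<in> {1..k} \<Longrightarrow> mvar i ^ 2 - mconst tpoly * mvar i \<in> I) \<Longrightarrow> C_ideal k \<subseteq> (I :: 'a::comm_ring_1 poly mpoly set)"
proof -
  interpret M: cring "mpoly_ring {1..k} :: 'a poly mpoly ring"
    by (rule cring_mpoly_ring)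
  have *: "(\<lambda>i. mvar i ^ 2 - mconst tpoly * mvar i :: 'a poly mpoly) ` {1..k} \<subseteq> carrier (mpoly_ring {1..k})"
    by (simp add: power2_eq_square image_subset_iff mvars_diff_subset mvars_mult_subset)
  show "ideal (C_ideal k) (mpoly_ring {1..k} :: 'a poly mpoly ring)"
    unfolding C_ideal_def by (rule M.genideal_ideal[OF *])
  show "i \<in> {1..k} \<Longrightarrow> mvar i ^ 2 - mconst tpoly * mvar i \<in> (C_ideal k :: 'a poly mpoly set)"
    unfolding C_ideal_def using M.genideal_self[OF *] by blast
  show "C_ideal k \<subseteq> I" if "ideal I (mpoly_ring {1..k})"
    "\<And>i. i \<in> {1..k} \<Longrightarrow> mvar i ^ 2 - mconst tpoly * mvar i \<in> I" for I :: "'a poly mpoly set"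
    unfolding C_ideal_def by (rule M.genideal_minimal) (use that in auto)
qed

lemma ideal_A_ideal: "ideal (A_ideal k :: 'a::comm_ring_1 mpoly set) (mpoly_ring {1..k})"
  and A_ideal_generator: "i \<in> {1..k} \<Longrightarrow> mvar i ^ 2 \<in> (A_ideal k :: 'a::comm_ring_1 mpoly set)"
  and A_ideal_minimal: "ideal I (mpoly_ring {1..k}) \<Longrightarrow>
    (\<And>i. i \<in> {1..k} \<Longrightarrow> mvar i ^ 2 \<in> I) \<Longrightarrow> A_ideal k \<subseteq> (I :: 'a::comm_ring_1 mpoly set)"
proof -
  interpret M: cring "mpoly_ring {1..k} :: 'a mpoly ring"
    by (rule cring_mpoly_ring)
  have *: "(\<lambda>i. mvar i ^ 2 :: 'a mpoly) ` {1..k} \<subseteq> carrier (mpoly_ring {1..k})"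
    by (simp add: power2_eq_square image_subset_iff mvars_mult_subset)
  show "ideal (A_ideal k) (mpoly_ring {1..k} :: 'a mpoly ring)"
    unfolding A_ideal_def by (rule M.genideal_ideal[OF *])
  show "i \<in> {1..k} \<Longrightarrow> mvar i ^ 2 \<in> (A_ideal k :: 'a mpoly set)"
    unfolding A_ideal_def using M.genideal_self[OF *] by blast
  show "A_ideal k \<subseteq> I" if "ideal I (mpoly_ring {1..k})"
    "\<And>i. i \<in> {1..k} \<Longrightarrow> mvar i ^ 2 \<in> I" for I :: "'a mpoly set"
    unfolding A_ideal_def by (rule M.genideal_minimal) (use that in auto)
qed

text \<open>Elements of \<open>R\<close> reach \<open>R[t][x\<^sub>1,\<dots>,x\<^sub>k]\<close> by two embeddings: into \<open>R[t]\<close>, then into the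
  polynomials over it.\<close>
abbreviation C_lift where
  "C_lift k p x v \<equiv> lifted_value k (\<lambda>a. mconst [:a:]) p x v"

lemma C_value_eq_sqfree_sum_iff:
  "C_value k p x v = sqfree_sum (C_ring k) (C_const k) (C_var k) k c \<longleftrightarrow>
     C_lift k p x v - sqfree_poly k c \<in> C_ideal k"
proof -
  have "C_value k p x v = C_ideal k +>\<^bsub>mpoly_ring {1..k}\<^esub> C_lift k p x v"
    unfolding C_value_def Let_def C_const_def C_var_def[abs_def] C_ring_def
    by (rule coset_lifted_value[OF ideal_C_ideal]) simp
  moreover have "sqfree_sum (C_ring k) (C_const k) (C_var k) k c =
      C_ideal k +>\<^bsub>mpoly_ring {1..k}\<^esub> sqfree_poly k c"
    unfolding C_const_def[abs_def] C_var_def[abs_def] C_ring_def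
    by (rule coset_sqfree_poly[OF ideal_C_ideal])
  ultimately show ?thesis
    by (simp add: coset_eq_iff ideal_C_ideal mvars_lifted_value mvars_sqfree_poly del: Pow_iff)
qed

lemma A_value_eq_sqfree_sum_iff:
  "A_value k p x v = sqfree_sum (A_ring k) (A_const k) (A_var k) k c \<longleftrightarrow>
     lifted_value k mconst p x v - sqfree_poly k c \<in> A_ideal k"
proof -
  have "A_value k p x v = A_ideal k +>\<^bsub>mpoly_ring {1..k}\<^esub> lifted_value k mconst p x v"
    unfolding A_value_def A_const_def[abs_def] A_var_def[abs_def] A_ring_def
    by (rule coset_lifted_value[OF ideal_A_ideal]) simp
  moreover have "sqfree_sum (A_ring k) (A_const k) (A_var k) k c =
      A_ideal k +>\<^bsub>mpoly_ring {1..k}\<^esub> sqfree_poly k c"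
    unfolding A_const_def[abs_def] A_var_def[abs_def] A_ring_def
    by (rule coset_sqfree_poly[OF ideal_A_ideal])
  ultimately show ?thesis
    by (simp add: coset_eq_iff ideal_A_ideal mvars_lifted_value mvars_sqfree_poly)
qed

section \<open>Squarefree monomials span $C_k$\<close>

lemma C_ideal_add: "f \<in> C_ideal k \<Longrightarrow> g \<in> C_ideal k \<Longrightarrow> f + g \<in> C_ideal k"
  using ideal.axioms(1)[OF ideal_C_ideal] additive_subgroup.a_closed by fastforce

lemma C_ideal_zero: "0 \<in> C_ideal k"
  using additive_subgroup.zero_closed[OF ideal.axioms(1)[OF ideal_C_ideal[of k]]] by simp

lemma C_ideal_mult: "mvars f \<subseteq> {1..k} \<Longrightarrow> g \<in> C_ideal k \<Longrightarrow> f * g \<in> C_ideal k"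
  using ideal.I_l_closed[OF ideal_C_ideal, of g k f] by simp

text \<open>This property is closed under sums and under multiplication by the variables, and it holds for
  constants; hence it holds for every polynomial in the variables \<open>x\<^sub>1,\<dots>,x\<^sub>k\<close>.\<close>
definition C_reducible :: "nat \<Rightarrow> 'a::comm_ring_1 poly mpoly \<Rightarrow> bool" where
  "C_reducible k f \<longleftrightarrow> (\<exists>c. f - sqfree_poly k c \<in> C_ideal k)"

lemma C_reducible_add:
  assumes "C_reducible k f" "C_reducible k g"
  shows "C_reducible k (f + g)"
proof -
  obtain c d where "f - sqfree_poly k c \<in> C_ideal k" "g - sqfree_poly k d \<in> C_ideal k"
    using assms by (auto simp: C_reducible_def)
  then have "(f - sqfree_poly k c) + (g - sqfree_poly k d) \<in> C_ideal k"
    by (rule C_ideal_add)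
  also have "(f - sqfree_poly k c) + (g - sqfree_poly k d) =
      (f + g) - sqfree_poly k (\<lambda>S. c S + d S)"
    by (simp add: sqfree_poly_altdef mconst_def single_add distrib_right sum.distrib)
  finally show ?thesis
    by (auto simp: C_reducible_def)
qed

lemma C_reducible_cong:
  assumes "C_reducible k g" "f - g \<in> C_ideal k"
  shows "C_reducible k f"
proof -
  obtain c where "g - sqfree_poly k c \<in> C_ideal k"
    using assms by (auto simp: C_reducible_def)
  with assms(2) have "(f - g) + (g - sqfree_poly k c) \<in> C_ideal k"
    by (rule C_ideal_add)
  then show ?thesis
    by (auto simp: C_reducible_def)
qed

lemma C_reducible_basis:
  assumes "S \<subseteq> {1..k}"
  shows "C_reducible k (mconst a * (\<Prod>i\<in>S. mvar i))"
proof -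
  have "sqfree_poly k (\<lambda>T. if T = S then a else 0) =
      (\<Sum>T\<in>Pow {1..k}. if T = S then mconst a * (\<Prod>i\<in>S. mvar i) else 0)"
    unfolding sqfree_poly_altdef by (rule sum.cong) (auto simp: mconst_def)
  also have "\<dots> = mconst a * (\<Prod>i\<in>S. mvar i)"
    using assms by simp
  finally have "mconst a * (\<Prod>i\<in>S. mvar i) - sqfree_poly k (\<lambda>T. if T = S then a else 0) \<in> C_ideal k"
    by (simp add: C_ideal_zero)
  then show ?thesis
    unfolding C_reducible_def by blast
qed

lemma C_reducible_sum:
  assumes "finite A" "\<And>a. a \<in> A \<Longrightarrow> C_reducible k (f a)"
  shows "C_reducible k (\<Sum>a\<in>A. f a)"
  using assms
proof (induction A)
  case empty
  show ?case
    using C_reducible_basis[of "{}" k 0] by (simp add: mconst_def)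
qed (simp add: C_reducible_add)

text \<open>A new variable enlarges the squarefree monomial; a repeated one is replaced by the factor \<open>t\<close>,
  by the defining relation \<open>x\<^sub>i\<^sup>2 = t x\<^sub>i\<close>.\<close>
lemma C_reducible_mvar_basis:
  assumes "S \<subseteq> {1..k}" "i \<in> {1..k}"
  shows "C_reducible k (mvar i * (mconst a * (\<Prod>j\<in>S. mvar j)))"
proof (cases "i \<in> S")
  case False
  then have "mvar i * (mconst a * (\<Prod>j\<in>S. mvar j)) = mconst a * (\<Prod>j\<in>insert i S. mvar j)"
    using finite_subset[OF assms(1)] by (simp add: mult_ac)
  then show ?thesis
    using C_reducible_basis[of "insert i S" k a] assms by simp
next
  case True
  let ?m = "\<Prod>j\<in>S - {i}. mvar j :: 'a poly mpoly"
  have prod_eq: "(\<Prod>j\<in>S. mvar j) = mvar i * ?m"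
    using True finite_subset[OF assms(1)] by (simp add: prod.remove)
  have "mvars (mconst a * ?m) \<subseteq> {1..k}"
    using assms by (intro mvars_mult_subset mvars_prod_subset) auto
  then have "(mconst a * ?m) * (mvar i ^ 2 - mconst tpoly * mvar i) \<in> C_ideal k"
    by (rule C_ideal_mult[OF _ C_ideal_generator[OF assms(2)]])
  also have "(mconst a * ?m) * (mvar i ^ 2 - mconst tpoly * mvar i) =
      mvar i * (mconst a * (\<Prod>j\<in>S. mvar j)) - mconst (tpoly * a) * (\<Prod>j\<in>S. mvar j)"
  proof -
    have "mconst (tpoly * a) = mconst tpoly * mconst a"
      by (simp only: mconst_def mult_single) simp
    then show ?thesis
      unfolding prod_eq power2_eq_square by (simp only: algebra_simps)
  qed
  finally show ?thesis
    by (rule C_reducible_cong[OF C_reducible_basis[OF assms(1)]])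
qed

lemma C_reducible_mvar:
  assumes "C_reducible k f" "i \<in> {1..k}"
  shows "C_reducible k (mvar i * f)"
proof -
  obtain c where c: "f - sqfree_poly k c \<in> C_ideal k"
    using assms by (auto simp: C_reducible_def)
  have "C_reducible k (mvar i * sqfree_poly k c)"
    unfolding sqfree_poly_altdef sum_distrib_left
    by (rule C_reducible_sum) (use assms in \<open>auto intro!: C_reducible_mvar_basis\<close>)
  moreover have "mvar i * (f - sqfree_poly k c) \<in> C_ideal k"
    using c assms by (intro C_ideal_mult) auto
  then have "mvar i * f - mvar i * sqfree_poly k c \<in> C_ideal k"
    by (simp add: algebra_simps)
  ultimately show ?thesis
    by (rule C_reducible_cong)
qed

lemma C_reducible_monomial:
  assumes "Poly_Mapping.keys m \<subseteq> {1..k}"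
  shows "C_reducible k (Poly_Mapping.single m a)"
proof -
  have pow: "C_reducible k (mvar i ^ n * f)" if "C_reducible k f" "i \<in> {1..k}"
    for i n and f :: "'a poly mpoly"
    using that by (induction n) (simp_all add: C_reducible_mvar mult.assoc)
  have "C_reducible k ((\<Prod>i\<in>B. mvar i ^ Poly_Mapping.lookup m i) * mconst a)"
    if "finite B" "B \<subseteq> {1..k}" for B
    using that
  proof (induction B)
    case empty
    show ?case using C_reducible_basis[of "{}" k a] by simp
  next
    case (insert i B)
    then show ?case by (simp add: pow mult.assoc)
  qed
  from this[of "Poly_Mapping.keys m"] assms
  have "C_reducible k ((\<Prod>i\<in>Poly_Mapping.keys m. mvar i ^ Poly_Mapping.lookup m i) * mconst a)"
    by simp
  also have "(\<Prod>i\<in>Poly_Mapping.keys m. mvar i ^ Poly_Mapping.lookup m i) * mconst a =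
      Poly_Mapping.single m a"
  proof -
    have pow_single: "mvar i ^ n = Poly_Mapping.single (Poly_Mapping.single i n) (1 :: 'a poly)" for i n
      by (induction n) (simp_all add: mvar_def mult_single plus_1_eq_Suc flip: Poly_Mapping.single_add)
    have "(\<Prod>i\<in>B. Poly_Mapping.single (g i) 1) = Poly_Mapping.single (\<Sum>i\<in>B. g i) (1 :: 'a poly)"
      if "finite B" for B and g :: "nat \<Rightarrow> nat \<Rightarrow>\<^sub>0 nat"
      using that by (induction B) (simp_all add: mult_single)
    then show ?thesis
      by (simp add: pow_single sum_single_lookup mconst_def mult_single)
  qed
  finally show ?thesis .
qed

lemma C_reducible_all:
  assumes "mvars f \<subseteq> {1..k}"
  shows "C_reducible k f"
proof -
  have "C_reducible k (\<Sum>m\<in>Poly_Mapping.keys f. Poly_Mapping.single m (Poly_Mapping.lookup f m))"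
    by (rule C_reducible_sum) (use assms in \<open>auto simp: mvars_def intro!: C_reducible_monomial\<close>)
  then show ?thesis by (simp add: sum_single_lookup)
qed

section \<open>Evaluation at the vertices of a cube of side $t$\<close>

text \<open>At the vertex of the cube \<open>{0, t}\<^sup>A\<close> indexed by \<open>J\<close>, a squarefree monomial vanishes unless
  all its variables lie in \<open>J\<close>.\<close>
lemma sum_Pow_vertex:
  fixes t :: "'b::comm_ring_1"
  assumes "finite A" "J \<subseteq> A"
  shows "(\<Sum>S\<in>Pow A. c S * (\<Prod>i\<in>S. if i \<in> J then t else 0)) = (\<Sum>S\<in>Pow J. t ^ card S * c S)"
proof -
  have "(\<Sum>S\<in>Pow J. t ^ card S * c S) = (\<Sum>S\<in>Pow J. c S * (\<Prod>i\<in>S. if i \<in> J then t else 0))"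
    by (rule sum.cong) (auto simp: mult.commute subset_iff)
  also have "\<dots> = (\<Sum>S\<in>Pow A. c S * (\<Prod>i\<in>S. if i \<in> J then t else 0))"
  proof (rule sum.mono_neutral_left)
    show "\<forall>S\<in>Pow A - Pow J. c S * (\<Prod>i\<in>S. if i \<in> J then t else 0) = 0"
    proof
      fix S assume "S \<in> Pow A - Pow J"
      then obtain i where "i \<in> S" "i \<notin> J" "finite S"
        using assms(1) finite_subset by auto
      then have "(\<Prod>i\<in>S. if i \<in> J then t else 0) = 0"
        by (intro prod_zero) auto
      then show "c S * (\<Prod>i\<in>S. if i \<in> J then t else 0) = 0" by simp
    qed
  qed (use assms in auto)
  finally show ?thesis by simp
qed

lemma shifted_point_at_vertex:
  fixes x :: "nat \<Rightarrow> 'a::comm_ring_1"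
  assumes "J \<subseteq> {1..k}"
  shows "shifted_point ring_of_type_algebra (\<lambda>a. [:a:]) (\<lambda>i. if i \<in> J then tpoly else 0) k x v =
    (\<lambda>j. [:x j:] + (\<Sum>i\<in>J. tpoly * [:v i j:]))"
proof
  fix j
  let ?f = "\<lambda>i. [:v i j:] * (if i \<in> J then tpoly else 0)"
  have "(\<Sum>i\<in>{1..k}. ?f i) = (\<Sum>i\<in>J. ?f i)"
    by (rule sum.mono_neutral_right) (use assms in auto)
  also have "\<dots> = (\<Sum>i\<in>J. tpoly * [:v i j:])"
    by (rule sum.cong) simp_all
  finally show "shifted_point ring_of_type_algebra (\<lambda>a. [:a:]) (\<lambda>i. if i \<in> J then tpoly else 0) k x v j =
      [:x j:] + (\<Sum>i\<in>J. tpoly * [:v i j:])"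
    by (simp only: shifted_point_def type_algebra_simps finsum_type_algebra)
qed

text \<open>Since \<open>0\<close> and \<open>t\<close> are roots of \<open>X\<^sup>2 - t X\<close>, setting \<open>x\<^sub>i = t\<close> for \<open>i \<in> J\<close> and \<open>x\<^sub>i = 0\<close>
  otherwise kills \<open>C_ideal k\<close>. The evaluation therefore does not see the difference between the
  value of \<open>p\<close> and its expansion.\<close>
lemma C_expansion_at_vertex:
  assumes "C_lift k p x v - sqfree_poly k c \<in> C_ideal k" "J \<subseteq> {1..k}"
  shows "mpoly_eval ring_of_type_algebra (\<lambda>a. [:a:]) p
      (\<lambda>j. [:x j:] + (\<Sum>i\<in>J. tpoly * [:v i j:])) = (\<Sum>S\<in>Pow J. tpoly ^ card S * c S)"
proof -
  define y where "y = (\<lambda>i. if i \<in> J then tpoly else (0 :: 'a poly))"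
  interpret L: mpoly_lifting "\<lambda>b. b" "monomial_value y"
    by (rule mpoly_lifting_eval)
  define ev where "ev = mpoly_lift (\<lambda>b. b) (monomial_value y)"
  have ev_mconst [simp]: "ev (mconst b) = b" for b
    by (simp add: ev_def)
  have ev_mvar [simp]: "ev (mvar i) = y i" for i
    unfolding ev_def by (subst L.lift_mvar) (rule monomial_value_single)
  have hom: "ev \<in> ring_hom (mpoly_ring {1..k}) ring_of_type_algebra"
    unfolding ev_def by (rule L.lift_ring_hom)
  note E = ring_hom_cring.intro[OF cring_mpoly_ring cring_from_type_algebra
      ring_hom_cring_axioms.intro[OF hom]]
  note E' = ring_hom_ring.intro[OF cring.axioms(1)[OF cring_mpoly_ring] ring_from_type_algebra
      ring_hom_ring_axioms.intro[OF hom]]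
  have "C_ideal k \<subseteq> {f \<in> carrier (mpoly_ring {1..k}). ev f \<in> {0}}"
  proof (rule C_ideal_minimal)
    show "ideal {f \<in> carrier (mpoly_ring {1..k}). ev f \<in> {0}} (mpoly_ring {1..k})"
      using ring_hom_ring.ideal_vimage[OF E' ring.zeroideal[OF ring_from_type_algebra]] by simp
    fix i assume i: "i \<in> {1..k}"
    have "ev (mvar i ^ 2 - mconst tpoly * mvar i) = ev (mvar i) ^ 2 - ev (mconst tpoly) * ev (mvar i)"
      by (simp only: ev_def power2_eq_square L.lift_diff L.lift_mult)
    also have "\<dots> = 0"
      unfolding ev_mconst ev_mvar by (simp only: y_def power2_eq_square) simp
    finally show "mvar i ^ 2 - mconst tpoly * mvar i \<in> {f \<in> carrier (mpoly_ring {1..k}). ev f \<in> {0}}"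
      using ideal.Icarr[OF ideal_C_ideal C_ideal_generator[OF i]] by blast
  qed
  with assms(1) have "ev (C_lift k p x v - sqfree_poly k c) = 0"
    by blast
  then have eq: "ev (C_lift k p x v) = ev (sqfree_poly k c)"
    by (simp add: ev_def L.lift_diff)
  have "ev (shifted_point (mpoly_ring {1..k}) (\<lambda>a. mconst [:a:]) mvar k x v j) =
      shifted_point ring_of_type_algebra (\<lambda>a. [:a:]) y k x v j" for j
    by (subst ring_hom_cring.hom_shifted_point[OF E]) simp_all
  then have "ev (C_lift k p x v) = mpoly_eval ring_of_type_algebra (\<lambda>a. [:a:]) p
      (shifted_point ring_of_type_algebra (\<lambda>a. [:a:]) y k x v)"
    unfolding lifted_value_def
    by (subst ring_hom_cring.hom_mpoly_eval[OF E]) (simp_all add: mvars_shifted_point)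
  moreover have "ev (sqfree_poly k c) = (\<Sum>S\<in>Pow {1..k}. c S * (\<Prod>i\<in>S. y i))"
    unfolding sqfree_poly_def by (subst ring_hom_cring.hom_sqfree_sum[OF E]) (auto simp: sqfree_sum_def)
  ultimately show ?thesis
    using eq sum_Pow_vertex[OF finite_atLeastAtMost assms(2), of c tpoly]
    unfolding shifted_point_at_vertex[OF assms(2), symmetric] y_def by simp
qed

text \<open>The value at the vertex \<open>J\<close> is the sum of \<open>t^card I * c I\<close> over the subsets \<open>I\<close> of \<open>J\<close>, and the
  alternating sum in the forward difference is the Moebius inversion of such subset sums.\<close>
lemma fwd_diff_t_eq:
  assumes "C_lift k p x v - sqfree_poly k c \<in> C_ideal k" "S \<subseteq> {1..k}"
  shows "fwd_diff_t p x v S = tpoly ^ card S * c S"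
proof -
  have "tpoly ^ card S * c S =
      (\<Sum>J\<in>Pow S. (-1) ^ (card S - card J) * (\<Sum>I\<in>Pow J. tpoly ^ card I * c I))"
    by (rule inclusion_exclusion_mobius) (use assms(2) finite_subset in auto)
  also have "\<dots> = fwd_diff_t p x v S"
    unfolding fwd_diff_t_def fwd_diff_def
    by (rule sum.cong[OF refl], subst C_expansion_at_vertex[OF assms(1)])
       (use assms(2) in auto)
  finally show ?thesis by simp
qed

text \<open>The power of \<open>t\<close> acts by shifting coefficients, hence it is cancellable over any commutative ring
  of coefficients, even one with zero divisors.\<close>
lemma tpoly_power_mult_cancel: "tpoly ^ n * q = tpoly ^ n * r \<longleftrightarrow> q = r"
proof -
  have tpoly_power: "tpoly ^ n = (monom 1 n :: 'a::comm_ring_1 poly)"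
    by (simp only: monom_altdef smult_1_left)
  have "q = r" if "monom 1 n * q = monom 1 n * r"
  proof (rule poly_eqI)
    fix i
    show "coeff q i = coeff r i"
      using arg_cong[OF that, of "\<lambda>f. coeff f (n + i)"] by (simp add: coeff_monom_mult)
  qed
  then show ?thesis
    unfolding tpoly_power by blast
qed

section \<open>Specialization at $t = 0$ and independence in $A_k$\<close>

lemma A_ideal_diff: "f \<in> A_ideal k \<Longrightarrow> g \<in> A_ideal k \<Longrightarrow> f - g \<in> A_ideal k"
proof -
  assume fg: "f \<in> A_ideal k" "g \<in> A_ideal k"
  interpret I: ideal "A_ideal k" "mpoly_ring {1..k} :: 'a mpoly ring"
    by (rule ideal_A_ideal)
  have "f \<oplus>\<^bsub>mpoly_ring {1..k}\<^esub> \<ominus>\<^bsub>mpoly_ring {1..k}\<^esub> g \<in> A_ideal k"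
    using fg
    by (intro additive_subgroup.a_closed additive_subgroup.a_inv_closed I.additive_subgroup_axioms)
  then show "f - g \<in> A_ideal k"
    using I.Icarr[OF fg(2)] by (simp add: mpoly_ring_uminus)
qed

text \<open>Linear independence of the squarefree monomials in \<open>A\<^sub>k\<close>: the polynomials all of whose monomials
  contain a square form an ideal that contains the generators of \<open>A_ideal k\<close>.\<close>
lemma sqfree_poly_in_A_ideal:
  assumes "sqfree_poly k c \<in> A_ideal k" "S \<subseteq> {1..k}"
  shows "c S = 0"
proof -
  define I where "I = {f :: 'a mpoly. mvars f \<subseteq> {1..k} \<and>
    (\<forall>m\<in>Poly_Mapping.keys f. \<exists>i. Poly_Mapping.lookup m i \<ge> 2)}"
  define ind where "ind S = (\<Sum>i\<in>S. Poly_Mapping.single i (1::nat))" for S :: "nat set"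
  interpret M: cring "mpoly_ring {1..k} :: 'a mpoly ring"
    by (rule cring_mpoly_ring)
  have mult: "f * g \<in> I" if "f \<in> I" "mvars g \<subseteq> {1..k}" for f g
  proof -
    have "\<exists>i. Poly_Mapping.lookup m i \<ge> 2" if m: "m \<in> Poly_Mapping.keys (f * g)" for m
    proof -
      obtain a b where "m = a + b" "a \<in> Poly_Mapping.keys f"
        using m keys_mult[of f g] by auto
      then show ?thesis
        using \<open>f \<in> I\<close> by (force simp: I_def lookup_add intro: trans_le_add1)
    qed
    then show ?thesis
      using that by (simp add: I_def mvars_mult_subset)
  qed
  have I: "ideal I (mpoly_ring {1..k})"
  proof (rule idealI)
    show "subgroup I (add_monoid (mpoly_ring {1..k}))"
    proof (rule M.add.subgroupI)
      fix f assume "f \<in> I"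
      then show "\<ominus>\<^bsub>mpoly_ring {1..k}\<^esub> f \<in> I"
        by (auto simp: I_def mpoly_ring_uminus Poly_Mapping.keys.rep_eq)
    next
      fix f g assume "f \<in> I" "g \<in> I"
      then show "f \<oplus>\<^bsub>mpoly_ring {1..k}\<^esub> g \<in> I"
        using Poly_Mapping.keys_add[of f g] mvars_add[of f g] by (auto simp: I_def)
    qed (auto simp: I_def intro!: exI[of _ 0])
  qed (auto simp: mult mult.commute M.ring_axioms)
  have "A_ideal k \<subseteq> I"
  proof (rule A_ideal_minimal[OF I])
    fix i assume "i \<in> {1..k}"
    moreover have "mvar i ^ 2 = Poly_Mapping.single (Poly_Mapping.single i 2) (1 :: 'a)"
      by (simp add: mvar_def power2_eq_square mult_single flip: Poly_Mapping.single_add)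
    ultimately show "mvar i ^ 2 \<in> I"
      by (auto simp: I_def mvars_def intro!: exI[of _ i])
  qed
  with assms(1) have in_I: "sqfree_poly k c \<in> I" by blast
  have fin: "finite T" if "T \<in> Pow {1..k}" for T
    using that finite_subset by auto
  have lookup_ind: "Poly_Mapping.lookup (ind T) i = (if i \<in> T then 1 else 0)" if "finite T" for T i
    using that by (simp add: ind_def lookup_sum lookup_single when_def)
  have prod_ind: "(\<Prod>i\<in>T. mvar i) = Poly_Mapping.single (ind T) (1 :: 'a)" if "finite T" for T
    using that by (induction T) (simp_all add: ind_def mvar_def mult_single)
  have inj_ind: "ind T = ind S \<longleftrightarrow> T = S" if "finite T" for T
  proof
    assume "ind T = ind S"
    then have "Poly_Mapping.lookup (ind T) i = Poly_Mapping.lookup (ind S) i" for i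
      by (rule arg_cong)
    then have "i \<in> T \<longleftrightarrow> i \<in> S" for i
      unfolding lookup_ind[OF that] lookup_ind[OF finite_subset[OF assms(2) finite_atLeastAtMost]]
      by (metis zero_neq_one)
    then show "T = S" by blast
  qed simp
  have "Poly_Mapping.lookup (sqfree_poly k c) (ind S) =
      (\<Sum>T\<in>Pow {1..k}. Poly_Mapping.lookup (Poly_Mapping.single (ind T) (c T)) (ind S))"
    unfolding sqfree_poly_altdef lookup_sum
    by (rule sum.cong) (simp_all add: fin prod_ind mconst_def mult_single del: Pow_iff)
  also have "\<dots> = (\<Sum>T\<in>Pow {1..k}. if T = S then c S else 0)"
    by (rule sum.cong) (simp_all add: fin inj_ind lookup_single when_def del: Pow_iff)
  also have "\<dots> = c S"
    using assms(2) by simp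
  finally have "Poly_Mapping.lookup (sqfree_poly k c) (ind S) = c S" .
  moreover have "ind S \<notin> Poly_Mapping.keys (sqfree_poly k c)"
  proof
    assume "ind S \<in> Poly_Mapping.keys (sqfree_poly k c)"
    with in_I obtain i where "Poly_Mapping.lookup (ind S) i \<ge> 2"
      by (auto simp: I_def)
    then show False
      using assms(2) by (simp add: lookup_ind fin split: if_splits)
  qed
  ultimately show ?thesis
    by (simp add: in_keys_iff)
qed

text \<open>Setting \<open>t = 0\<close> in every coefficient sends \<open>x\<^sub>i\<^sup>2 - t x\<^sub>i\<close> to \<open>x\<^sub>i\<^sup>2\<close>, so it carries congruences
  modulo \<open>C_ideal k\<close> to congruences modulo \<open>A_ideal k\<close>, while \<open>p\<close>, \<open>x\<close> and \<open>v\<close>, being constant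
  in \<open>t\<close>, are unchanged.\<close>
lemma specialization_C_to_A:
  assumes "C_lift k p x v - sqfree_poly k c \<in> C_ideal k"
  shows "lifted_value k mconst p x v - sqfree_poly k (\<lambda>S. poly (c S) 0) \<in> A_ideal k"
proof -
  let ?\<phi> = "\<lambda>q :: 'a poly. mconst (poly q 0)" and ?\<mu> = "\<lambda>m. Poly_Mapping.single m (1 :: 'a)"
  interpret L: mpoly_lifting ?\<phi> ?\<mu>
    by (rule mpoly_lifting_coeff_hom)
  define h where "h = mpoly_lift ?\<phi> ?\<mu>"
  have h_mconst [simp]: "h (mconst b) = mconst (poly b 0)" for b
    by (simp add: h_def)
  have h_mvar [simp]: "h (mvar i) = mvar i" for i
    unfolding h_def by (subst L.lift_mvar) (simp add: mvar_def flip: single_one)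
  have h_mvars: "mvars (h f) \<subseteq> V" if "mvars f \<subseteq> V" for f V
    unfolding h_def mpoly_lift_def
  proof (intro mvars_sum_subset mvars_mult_subset)
    fix m assume "m \<in> Poly_Mapping.keys f"
    then show "mvars (Poly_Mapping.single m (1 :: 'a)) \<subseteq> V"
      using that mvars_single[of m "1 :: 'a"] unfolding mvars_def[of f] by blast
  qed simp
  have hom: "h \<in> ring_hom (mpoly_ring {1..k}) (mpoly_ring {1..k})"
    by (rule ring_hom_memI)
       (simp_all add: h_mvars, simp_all add: h_def L.lift_add L.lift_mult L.lift_one)
  note E = ring_hom_cring.intro[OF cring_mpoly_ring cring_mpoly_ring
      ring_hom_cring_axioms.intro[OF hom]]
  note E' = ring_hom_ring.intro[OF cring.axioms(1)[OF cring_mpoly_ring]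
      cring.axioms(1)[OF cring_mpoly_ring] ring_hom_ring_axioms.intro[OF hom]]
  have "C_ideal k \<subseteq> {f \<in> carrier (mpoly_ring {1..k}). h f \<in> A_ideal k}"
  proof (rule C_ideal_minimal)
    show "ideal {f \<in> carrier (mpoly_ring {1..k}). h f \<in> A_ideal k} (mpoly_ring {1..k})"
      by (rule ring_hom_ring.ideal_vimage[OF E' ideal_A_ideal])
    fix i assume i: "i \<in> {1..k}"
    have "h (mvar i ^ 2 - mconst tpoly * mvar i) = h (mvar i) ^ 2 - h (mconst tpoly) * h (mvar i)"
      by (simp only: h_def power2_eq_square L.lift_diff L.lift_mult)
    also have "\<dots> = mvar i ^ 2"
      unfolding h_mconst h_mvar by (simp add: mconst_def)
    also have "\<dots> \<in> A_ideal k"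
      by (rule A_ideal_generator[OF i])
    finally show "mvar i ^ 2 - mconst tpoly * mvar i \<in> {f \<in> carrier (mpoly_ring {1..k}). h f \<in> A_ideal k}"
      using ideal.Icarr[OF ideal_C_ideal C_ideal_generator[OF i]] by blast
  qed
  with assms have "h (C_lift k p x v - sqfree_poly k c) \<in> A_ideal k"
    by blast
  moreover have "h (shifted_point (mpoly_ring {1..k}) (\<lambda>a. mconst [:a:]) mvar k x v j) =
      shifted_point (mpoly_ring {1..k}) mconst mvar k x v j" for j
    by (subst ring_hom_cring.hom_shifted_point[OF E]) simp_all
  then have "h (C_lift k p x v) = lifted_value k mconst p x v"
    unfolding lifted_value_def
    by (subst ring_hom_cring.hom_mpoly_eval[OF E]) (simp_all add: mvars_shifted_point)
  moreover have "h (sqfree_poly k c) = sqfree_poly k (\<lambda>S. poly (c S) 0)"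
    unfolding sqfree_poly_def by (subst ring_hom_cring.hom_sqfree_sum[OF E]) (auto simp: sqfree_sum_def)
  ultimately show ?thesis
    by (simp add: h_def L.lift_diff)
qed

lemma D_coeff_eq:
  assumes "C_lift k p x v - sqfree_poly k c \<in> C_ideal k" "S \<subseteq> {1..k}"
  shows "D_coeff k p x v S = poly (c S) 0"
  unfolding D_coeff_def A_value_eq_sqfree_sum_iff
proof (rule the_equality)
  let ?P = "lifted_value k mconst p x v"
  have P: "?P - sqfree_poly k (\<lambda>S. poly (c S) 0) \<in> A_ideal k"
    by (rule specialization_C_to_A) fact
  then show "\<exists>d. ?P - sqfree_poly k d \<in> A_ideal k \<and> poly (c S) 0 = d S"
    by blast
  fix a assume "\<exists>d. ?P - sqfree_poly k d \<in> A_ideal k \<and> a = d S"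
  then obtain d where d: "?P - sqfree_poly k d \<in> A_ideal k" "a = d S"
    by blast
  let ?e = "\<lambda>S. d S - poly (c S) 0"
  have "lifted_value k mconst p x v - sqfree_poly k (\<lambda>S. poly (c S) 0)
      - (lifted_value k mconst p x v - sqfree_poly k d) \<in> A_ideal k"
    by (rule A_ideal_diff[OF P d(1)])
  then have "sqfree_poly k d - sqfree_poly k (\<lambda>S. poly (c S) 0) \<in> A_ideal k"
    by (simp add: algebra_simps)
  also have "sqfree_poly k d - sqfree_poly k (\<lambda>S. poly (c S) 0) = sqfree_poly k ?e"
    by (simp add: sqfree_poly_altdef mconst_def single_diff left_diff_distrib sum_subtractf)
  finally have "?e S = 0"
    by (rule sqfree_poly_in_A_ideal) fact
  with d(2) show "a = poly (c S) 0" by simp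
qed

theorem proposition33:
  fixes p :: "'a::comm_ring_1 mpoly"
    and x :: "nat \<Rightarrow> 'a"
    and v :: "nat \<Rightarrow> nat \<Rightarrow> 'a"
    and d k :: nat
  assumes "p \<in> carrier (mpoly_ring {1..d})"
  shows "(\<exists>c. C_value k p x v = sqfree_sum (C_ring k) (C_const k) (C_var k) k c)
    \<and> (\<forall>c. C_value k p x v = sqfree_sum (C_ring k) (C_const k) (C_var k) k c \<longrightarrow>
          (\<forall>S \<subseteq> {1..k}.
             (\<forall>q. tpoly ^ card S * q = fwd_diff_t p x v S \<longleftrightarrow> q = c S)
             \<and> poly (c S) 0 = D_coeff k p x v S))
    \<and> tpoly ^ k dvd fwd_diff_t p x v {1..k}"
  unfolding C_value_eq_sqfree_sum_iff
proof (intro conjI allI impI)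
  have "C_reducible k (C_lift k p x v)"
    by (intro C_reducible_all mvars_lifted_value) simp
  then obtain c where c: "C_lift k p x v - sqfree_poly k c \<in> C_ideal k"
    unfolding C_reducible_def by blast
  then show "\<exists>c. C_lift k p x v - sqfree_poly k c \<in> C_ideal k"
    by blast
  show "tpoly ^ k dvd fwd_diff_t p x v {1..k}"
    using fwd_diff_t_eq[OF c, of "{1..k}"] by simp
next
  fix c S q
  assume "C_lift k p x v - sqfree_poly k c \<in> C_ideal k" "S \<subseteq> {1..k}"
  then show "tpoly ^ card S * q = fwd_diff_t p x v S \<longleftrightarrow> q = c S"
    by (simp add: fwd_diff_t_eq tpoly_power_mult_cancel)
next
  fix c S
  assume "C_lift k p x v - sqfree_poly k c \<in> C_ideal k" "S \<subseteq> {1..k}"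
  then show "poly (c S) 0 = D_coeff k p x v S"
    by (simp add: D_coeff_eq)
qed

end
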